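(* Every tight finite game has a completely mixed Nash equilibrium, i.e. a Nash equilibrium $\sigma$ such that $\sigma_i(c_i)>0$ for every player $i$ and every pure strategy $c_i$ of player $i$.
   Context: A finite game in strategic form is $\Gamma=(N,(C_i)_{i\in N},(U_i)_{i\in N})$, where $N$ is a finite nonempty set of players, $C_i$ is the finite nonempty set of pure strategies of player $i$, $C=\prod_{j\in N}C_j$, $C_{-i}=\prod_{j\ne i}C_j$, and $U_i:C\to\mathbb{R}$ is the utility function of player $i$, extended multilinearly to mixed strategies. A correlated equilibrium of $\Gamma$ is a probability distribution $\mu\in\Delta(C)$ such that $\sum_{c_{-i}\in C_{-i}}\mu(c)[U_i(c_{-i},d_i)-U_i(c)]\le 0$ for all $i\in N$, $c_i\in C_i$, $d_i\in C_i$ (where $c=(c_{-i},c_i)$). The game is tight if in every correlated equilibrium $\mu$ all these incentive constraints hold with equality: $\sum_{c_{-i}\in C_{-i}}\mu(c)[U_i(c_{-i},d_i)-U_i(c)]=0$ for all $i\in N$, $c_i\in C_i$, $d_i\in C_i$. *)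

theory Defs
  imports "HOL-Probability.Probability"
begin

text \<open>
  A finite game has player set \<open>N\<close>, pure strategy sets \<open>C i\<close> for \<open>i \<in> N\<close>, and utilities
  \<open>U i\<close> on pure profiles. The strategy sets share the carrier type \<open>'s\<close>; this is no restriction,
  as any family of types embeds into its disjoint sum. Profiles of the players in \<open>N\<close> are
  the elements of \<open>Pi\<^sub>E N C\<close>, and \<open>C\<^sub>-\<^sub>i\<close> is \<open>Pi\<^sub>E (N - {i}) C\<close>, so that the profile
  \<open>(c\<^sub>-\<^sub>i, d\<^sub>i)\<close> is the function update \<open>c(i := d)\<close>.
\<close>

definition finite_game :: "'i set \<Rightarrow> ('i \<Rightarrow> 's set) \<Rightarrow> bool" where
  "finite_game N C \<longleftrightarrow>
     finite N \<and> N \<noteq> {} \<and> (\<forall>i\<in>N. finite (C i) \<and> C i \<noteq> {})"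

abbreviation profiles :: "'i set \<Rightarrow> ('i \<Rightarrow> 's set) \<Rightarrow> ('i \<Rightarrow> 's) set" where
  "profiles N C \<equiv> Pi\<^sub>E N C"

abbreviation profiles_without :: "'i set \<Rightarrow> ('i \<Rightarrow> 's set) \<Rightarrow> 'i \<Rightarrow> ('i \<Rightarrow> 's) set" where
  "profiles_without N C i \<equiv> Pi\<^sub>E (N - {i}) C"

definition distributions_on :: "'a set \<Rightarrow> 'a pmf set" where
  "distributions_on A = {p. set_pmf p \<subseteq> A}"

definition incentive ::
  "'i set \<Rightarrow> ('i \<Rightarrow> 's set) \<Rightarrow> ('i \<Rightarrow> ('i \<Rightarrow> 's) \<Rightarrow> real) \<Rightarrow> ('i \<Rightarrow> 's) pmf \<Rightarrow> 'i \<Rightarrow> 's \<Rightarrow> 's \<Rightarrow> real"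
where
  "incentive N C U \<mu> i ci di =
     (\<Sum>c\<in>profiles_without N C i.
        pmf \<mu> (c(i := ci)) * (U i (c(i := di)) - U i (c(i := ci))))"

definition correlated_equilibrium ::
  "'i set \<Rightarrow> ('i \<Rightarrow> 's set) \<Rightarrow> ('i \<Rightarrow> ('i \<Rightarrow> 's) \<Rightarrow> real) \<Rightarrow> ('i \<Rightarrow> 's) pmf \<Rightarrow> bool"
where
  "correlated_equilibrium N C U \<mu> \<longleftrightarrow>
     \<mu> \<in> distributions_on (profiles N C) \<and>
     (\<forall>i\<in>N. \<forall>ci\<in>C i. \<forall>di\<in>C i. incentive N C U \<mu> i ci di \<le> 0)"

definition tight_game ::
  "'i set \<Rightarrow> ('i \<Rightarrow> 's set) \<Rightarrow> ('i \<Rightarrow> ('i \<Rightarrow> 's) \<Rightarrow> real) \<Rightarrow> bool"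
where
  "tight_game N C U \<longleftrightarrow>
     (\<forall>\<mu>. correlated_equilibrium N C U \<mu> \<longrightarrow>
        (\<forall>i\<in>N. \<forall>ci\<in>C i. \<forall>di\<in>C i. incentive N C U \<mu> i ci di = 0))"

text \<open>
  Mixed profiles assign a distribution on \<open>C i\<close> to each \<open>i \<in> N\<close>; values at indices outside
  \<open>N\<close> are irrelevant.
\<close>

definition mixed_profile :: "'i set \<Rightarrow> ('i \<Rightarrow> 's set) \<Rightarrow> ('i \<Rightarrow> 's pmf) \<Rightarrow> bool" where
  "mixed_profile N C \<sigma> \<longleftrightarrow> (\<forall>i\<in>N. \<sigma> i \<in> distributions_on (C i))"

definition mixed_utility ::
  "'i set \<Rightarrow> ('i \<Rightarrow> 's set) \<Rightarrow> ('i \<Rightarrow> ('i \<Rightarrow> 's) \<Rightarrow> real) \<Rightarrow> 'i \<Rightarrow> ('i \<Rightarrow> 's pmf) \<Rightarrow> real"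
where
  "mixed_utility N C U i \<sigma> = (\<Sum>c\<in>profiles N C. (\<Prod>j\<in>N. pmf (\<sigma> j) (c j)) * U i c)"

definition nash_equilibrium ::
  "'i set \<Rightarrow> ('i \<Rightarrow> 's set) \<Rightarrow> ('i \<Rightarrow> ('i \<Rightarrow> 's) \<Rightarrow> real) \<Rightarrow> ('i \<Rightarrow> 's pmf) \<Rightarrow> bool"
where
  "nash_equilibrium N C U \<sigma> \<longleftrightarrow>
     mixed_profile N C \<sigma> \<and>
     (\<forall>i\<in>N. \<forall>\<tau>\<in>distributions_on (C i).
        mixed_utility N C U i (\<sigma>(i := \<tau>)) \<le> mixed_utility N C U i \<sigma>)"

definition completely_mixed :: "'i set \<Rightarrow> ('i \<Rightarrow> 's set) \<Rightarrow> ('i \<Rightarrow> 's pmf) \<Rightarrow> bool" where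
  "completely_mixed N C \<sigma> \<longleftrightarrow> (\<forall>i\<in>N. \<forall>ci\<in>C i. pmf (\<sigma> i) ci > 0)"

end

theory Submission imports Defs begin

text \<open>
  Correlated equilibria are the distributions satisfying a finite system of linear incentive
  inequalities. Tightness says that these inequalities imply their own reverses, so linear duality
  (\<open>tight_game_dual\<close>) produces multipliers \<open>\<alpha> i e d > 0\<close>, one for each player \<open>i\<close> and
  each pair of strategies \<open>e\<close>, \<open>d\<close>, such that at every pure profile \<open>c\<close>
  \[ \sum_i \sum_d \alpha_i(c_i,d)\,\bigl(U_i(c_{-i},d) - U_i(c)\bigr) \ge 0 . \]

  Read \<open>\<alpha> i\<close> as the jump rates of a Markov chain on \<open>C i\<close>. All rates are positive, so the
  chain has a stationary distribution \<open>\<sigma> i\<close> of full support (\<open>stationary_pmf_exists\<close>). The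
  profile \<open>\<sigma>\<close> is the desired equilibrium. To see this, fix a player \<open>k\<close> and a strategy \<open>e\<close>,
  and average the displayed inequality over profiles in which \<open>k\<close> plays \<open>e\<close> and every other player
  \<open>i\<close> plays \<open>\<sigma> i\<close> independently. The term of each \<open>i \<noteq> k\<close> vanishes by stationarity. With
  \<open>V d\<close> the expected payoff of \<open>k\<close> from playing \<open>d\<close> against the others, what remains is
  \[ \sum_d \alpha_k(e,d)\,\bigl(V(d) - V(e)\bigr) \ge 0 \qquad\text{for every } e . \]
  At a maximiser \<open>e\<close> of \<open>V\<close> no summand is positive, so all vanish, and as the rates are positive
  \<open>V\<close> is constant (\<open>nonneg_drift_imp_constant\<close>). Thus \<open>k\<close> is indifferent between all strategies
  against \<open>\<sigma>\<close>, and \<open>\<sigma>\<close> is a Nash equilibrium. Both the multipliers and the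
  stationary distributions come from Farkas' lemma.
\<close>

section \<open>Linear inequalities\<close>

text \<open>
  Farkas' lemma, by induction on the number of constraints (Bartl's argument). If the last
  constraint \<open>m\<close> is not redundant, some \<open>y\<close> satisfies the other constraints but has
  \<open>b y > 0\<close>; then \<open>a m y > 0\<close>. Replacing each functional by its composition with the projection
  along \<open>y\<close> onto the kernel of \<open>a m\<close> leaves an implication without constraint \<open>m\<close>. Undoing the
  projection in the resulting representation of \<open>b\<close> costs only a multiple of \<open>a m\<close>,
  whose coefficient is nonnegative by the choice of \<open>y\<close>.
\<close>

lemma farkas:
  fixes a :: "'j \<Rightarrow> 'x \<Rightarrow> real" and b :: "'x \<Rightarrow> real"
  assumes "finite J" "finite X"
    and "\<And>x. (\<And>j. j \<in> J \<Longrightarrow> (\<Sum>c\<in>X. a j c * x c) \<le> 0) \<Longrightarrow> (\<Sum>c\<in>X. b c * x c) \<le> 0"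
  shows "\<exists>l. (\<forall>j\<in>J. 0 \<le> l j) \<and> (\<forall>c\<in>X. b c = (\<Sum>j\<in>J. l j * a j c))"
  using assms(1,3)
proof (induction J arbitrary: a b rule: finite_induct)
  case empty
  have "(\<Sum>c\<in>X. b c * b c) \<le> 0"
    by (rule empty) simp
  then have "(\<Sum>c\<in>X. b c * b c) = 0"
    by (intro antisym sum_nonneg) auto
  then have "\<forall>c\<in>X. b c = 0"
    using assms(2) by (subst (asm) sum_nonneg_eq_0_iff) auto
  then show ?case by simp
next
  case (insert m J)
  define dot :: "('x \<Rightarrow> real) \<Rightarrow> ('x \<Rightarrow> real) \<Rightarrow> real" where "dot u v = (\<Sum>c\<in>X. u c * v c)" for u v
  have hyp: "dot b x \<le> 0" if "\<And>j. j \<in> insert m J \<Longrightarrow> dot (a j) x \<le> 0" for x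
    using insert.prems that unfolding dot_def by blast
  show ?case
  proof (cases "\<forall>x. (\<forall>j\<in>J. dot (a j) x \<le> 0) \<longrightarrow> dot b x \<le> 0")
    case True
    then obtain l where l: "\<forall>j\<in>J. 0 \<le> l j" "\<forall>c\<in>X. b c = (\<Sum>j\<in>J. l j * a j c)"
      using insert.IH[of a b] unfolding dot_def by blast
    have "(\<Sum>j\<in>J. (l(m := 0)) j * a j c) = (\<Sum>j\<in>J. l j * a j c)" for c
      by (rule sum.cong) (use insert.hyps in auto)
    with l insert.hyps show ?thesis
      by (intro exI[of _ "l(m := 0)"]) auto
  next
    case False
    then obtain y where y: "\<forall>j\<in>J. dot (a j) y \<le> 0" "dot b y > 0"
      by force
    define s where "s = dot (a m) y"
    have s: "s > 0"
      using hyp[of y] y unfolding s_def by force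
    \<comment> \<open>\<open>p u\<close> is the functional \<open>u\<close> composed with the projection along \<open>y\<close> onto the kernel of \<open>a m\<close>.\<close>
    define p where "p u c = u c - dot u y / s * a m c" for u c
    have dot_p: "dot (p u) x = dot u (\<lambda>c. x c - dot (a m) x / s * y c)" for u x
    proof -
      have "dot (p u) x = dot u x - dot u y / s * dot (a m) x"
        unfolding dot_def p_def
        by (simp add: left_diff_distrib sum_subtractf sum_distrib_left mult.assoc)
      also have "\<dots> = dot u (\<lambda>c. x c - dot (a m) x / s * y c)"
        unfolding dot_def
        by (simp add: right_diff_distrib sum_subtractf sum_distrib_left sum_distrib_right
            sum_divide_distrib mult_ac)
      finally show ?thesis .
    qed
    have "dot (p b) x \<le> 0" if x: "\<And>j. j \<in> J \<Longrightarrow> dot (p (a j)) x \<le> 0" for x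
    proof -
      have "dot (a m) (\<lambda>c. x c - dot (a m) x / s * y c) = 0"
        unfolding dot_p[symmetric] unfolding p_def s_def[symmetric] using s
        by (simp add: dot_def)
      then show ?thesis
        using x unfolding dot_p by (intro hyp) auto
    qed
    then obtain l where l: "\<forall>j\<in>J. 0 \<le> l j" "\<forall>c\<in>X. p b c = (\<Sum>j\<in>J. l j * p (a j) c)"
      using insert.IH[of "\<lambda>j. p (a j)" "p b"] unfolding dot_def by blast
    \<comment> \<open>The multiple of \<open>a m\<close> that is left over when the projection in \<open>l(2)\<close> is written out.\<close>
    define t where "t = (dot b y - (\<Sum>j\<in>J. l j * dot (a j) y)) / s"
    have "(\<Sum>j\<in>J. l j * dot (a j) y) \<le> 0"
      using l(1) y(1) by (intro sum_nonpos) (auto intro: mult_nonneg_nonpos)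
    then have t: "0 \<le> t"
      using y(2) s unfolding t_def by (auto intro!: divide_nonneg_pos)
    have "b c = t * a m c + (\<Sum>j\<in>J. l j * a j c)" if "c \<in> X" for c
    proof -
      have "b c - dot b y / s * a m c = (\<Sum>j\<in>J. l j * (a j c - dot (a j) y / s * a m c))"
        using l(2) that unfolding p_def by simp
      also have "\<dots> = (\<Sum>j\<in>J. l j * a j c) - (\<Sum>j\<in>J. l j * dot (a j) y) / s * a m c"
        by (simp add: right_diff_distrib sum_subtractf sum_distrib_left sum_divide_distrib mult_ac)
      finally show ?thesis
        unfolding t_def by (simp add: algebra_simps diff_divide_distrib)
    qed
    moreover have "(\<Sum>j\<in>J. (l(m := t)) j * a j c) = (\<Sum>j\<in>J. l j * a j c)" for c
      by (rule sum.cong) (use insert.hyps in auto)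
    ultimately show ?thesis
      using l(1) t insert.hyps by (intro exI[of _ "l(m := t)"]) auto
  qed
qed

text \<open>
  Sign constraints on \<open>x\<close> are further constraints, indexed by the right summand of \<open>J <+> X\<close>;
  dropping their multipliers turns the equation of \<open>farkas\<close> into an inequality.
\<close>

lemma farkas_nonneg:
  fixes a :: "'j \<Rightarrow> 'x \<Rightarrow> real" and b :: "'x \<Rightarrow> real"
  assumes "finite J" "finite X"
    and imp: "\<And>x. (\<And>c. c \<in> X \<Longrightarrow> 0 \<le> x c) \<Longrightarrow> (\<And>j. j \<in> J \<Longrightarrow> (\<Sum>c\<in>X. a j c * x c) \<le> 0)
      \<Longrightarrow> (\<Sum>c\<in>X. b c * x c) \<le> 0"
  shows "\<exists>l. (\<forall>j\<in>J. 0 \<le> l j) \<and> (\<forall>c\<in>X. b c \<le> (\<Sum>j\<in>J. l j * a j c))"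
proof -
  define a' where "a' = case_sum a (\<lambda>e c. if c = e then - 1 else 0 :: real)"
  have a'_Inr: "(\<Sum>c\<in>X. a' (Inr e) c * x c) = - x e" if "e \<in> X" for e x
    using that assms(2) unfolding a'_def by (simp add: if_distrib[of "\<lambda>z. z * _"] cong: if_cong)
  have "(\<Sum>c\<in>X. b c * x c) \<le> 0"
    if x: "\<And>j. j \<in> J <+> X \<Longrightarrow> (\<Sum>c\<in>X. a' j c * x c) \<le> 0" for x
  proof (rule imp)
    show "0 \<le> x c" if "c \<in> X" for c
      using x[OF InrI[OF that]] that by (simp add: a'_Inr)
    show "(\<Sum>c\<in>X. a j c * x c) \<le> 0" if "j \<in> J" for j
      using x[of "Inl j"] that by (auto simp: a'_def)
  qed
  then obtain l where l: "\<forall>j\<in>J <+> X. 0 \<le> l j"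
      "\<forall>c\<in>X. b c = (\<Sum>j\<in>J <+> X. l j * a' j c)"
    using farkas[of "J <+> X" X a' b] assms by auto
  have "b c \<le> (\<Sum>j\<in>J. l (Inl j) * a j c)" if "c \<in> X" for c
  proof -
    have "(\<Sum>e\<in>X. l (Inr e) * a' (Inr e) c) \<le> 0"
      using l(1) by (intro sum_nonpos) (auto simp: a'_def)
    then show ?thesis
      using l(2) that assms(1,2) by (simp add: sum.Plus a'_def)
  qed
  then show ?thesis
    using l(1) by (intro exI[of _ "\<lambda>j. l (Inl j)"]) auto
qed

section \<open>Stationary distributions of positive jump rates\<close>

text \<open>
  Balance of inflow and outflow for jump rates \<open>r\<close>; the summand \<open>p d * r d d\<close> occurs on both
  sides and cancels.
\<close>

definition stationary :: "'s set \<Rightarrow> ('s \<Rightarrow> 's \<Rightarrow> real) \<Rightarrow> ('s \<Rightarrow> real) \<Rightarrow> bool" where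
  "stationary S r p \<longleftrightarrow> (\<forall>d\<in>S. (\<Sum>c\<in>S. p c * r c d) = p d * (\<Sum>e\<in>S. r d e))"

lemma stationary_mean_drift:
  assumes "stationary S r p"
  shows "(\<Sum>c\<in>S. p c * (\<Sum>d\<in>S. r c d * (f d - f c))) = 0"
proof -
  have "(\<Sum>c\<in>S. p c * (\<Sum>d\<in>S. r c d * (f d - f c)))
      = (\<Sum>c\<in>S. \<Sum>d\<in>S. p c * r c d * f d) - (\<Sum>c\<in>S. p c * (\<Sum>d\<in>S. r c d) * f c)"
    by (simp add: right_diff_distrib sum_subtractf sum_distrib_left sum_distrib_right mult_ac)
  also have "(\<Sum>c\<in>S. \<Sum>d\<in>S. p c * r c d * f d) = (\<Sum>d\<in>S. (\<Sum>c\<in>S. p c * r c d) * f d)"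
    by (subst sum.swap) (simp add: sum_distrib_right)
  also have "\<dots> = (\<Sum>d\<in>S. p d * (\<Sum>e\<in>S. r d e) * f d)"
    using assms unfolding stationary_def by (intro sum.cong) auto
  finally show ?thesis by simp
qed

lemma pmf_of_weights:
  fixes f :: "'a \<Rightarrow> real"
  assumes "finite A" "\<And>x. x \<in> A \<Longrightarrow> 0 \<le> f x" "0 < sum f A"
  obtains p where "p \<in> distributions_on A" "\<And>x. x \<in> A \<Longrightarrow> pmf p x = f x / sum f A"
proof -
  define g where "g x = (if x \<in> A then f x / sum f A else 0)" for x
  have nonneg: "0 \<le> g x" for x
    using assms unfolding g_def by auto
  have "(\<integral>\<^sup>+x. ennreal (g x) \<partial>count_space UNIV) = (\<Sum>x\<in>A. ennreal (g x))"
    using assms(1) by (intro nn_integral_count_space') (auto simp: g_def)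
  also have "\<dots> = ennreal (\<Sum>x\<in>A. g x)"
    using nonneg by simp
  also have "(\<Sum>x\<in>A. g x) = 1"
    using assms(3) by (simp add: g_def flip: sum_divide_distrib)
  finally have pmf: "pmf (embed_pmf g) x = g x" for x
    using nonneg by (intro pmf_embed_pmf) auto
  show thesis
  proof
    show "embed_pmf g \<in> distributions_on A"
      unfolding distributions_on_def by (auto simp: set_pmf_iff pmf g_def split: if_splits)
    show "pmf (embed_pmf g) x = f x / sum f A" if "x \<in> A" for x
      using that by (simp add: pmf g_def)
  qed
qed

text \<open>
  The maximum principle: at a maximiser of \<open>f\<close> the drift is a sum of nonpositive terms, so a
  nonnegative drift forces every term, hence by positivity of the rates every difference, to vanish.
\<close>

lemma nonneg_drift_imp_constant:
  fixes f :: "'s \<Rightarrow> real"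
  assumes "finite S" and r: "\<And>c d. c \<in> S \<Longrightarrow> d \<in> S \<Longrightarrow> 0 < r c d"
    and drift: "\<And>c. c \<in> S \<Longrightarrow> 0 \<le> (\<Sum>d\<in>S. r c d * (f d - f c))"
    and "c \<in> S" "d \<in> S"
  shows "f c = f d"
proof -
  have ne: "S \<noteq> {}" using \<open>c \<in> S\<close> by auto
  obtain m where m: "m \<in> S" "\<And>d. d \<in> S \<Longrightarrow> f d \<le> f m"
    using obtains_MAX[OF assms(1) ne, of f] assms(1) by (metis Max_ge finite_imageI imageI)
  have terms: "0 \<le> r m e * (f m - f e)" if "e \<in> S" for e
    using m r that by (simp add: less_imp_le)
  have "(\<Sum>e\<in>S. r m e * (f m - f e)) = - (\<Sum>e\<in>S. r m e * (f e - f m))"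
    by (simp add: algebra_simps flip: sum_negf)
  then have "(\<Sum>e\<in>S. r m e * (f m - f e)) = 0"
    using drift[OF m(1)] sum_nonneg[of S "\<lambda>e. r m e * (f m - f e)", OF terms] by linarith
  then have "\<forall>e\<in>S. r m e * (f m - f e) = 0"
    using assms(1) terms by (subst (asm) sum_nonneg_eq_0_iff) auto
  then have "f e = f m" if "e \<in> S" for e
    using r[OF m(1) that] that by force
  then show ?thesis
    using \<open>c \<in> S\<close> \<open>d \<in> S\<close> by simp
qed

text \<open>
  A stationary vector is a nonzero \<open>x \<ge> 0\<close> whose net inflow is nonpositive at each state; since the
  net inflows add up to zero, they then all vanish. If there were no such vector, Farkas' lemma
  would give a function \<open>l\<close> with drift at least \<open>1\<close> everywhere, contradicting the maximum
  principle. Full support follows because a state of mass zero would have no inflow, although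
  any state that carries mass feeds it at a positive rate.
\<close>

lemma stationary_pmf_exists:
  fixes r :: "'s \<Rightarrow> 's \<Rightarrow> real"
  assumes "finite S" "S \<noteq> {}" and r: "\<And>c d. c \<in> S \<Longrightarrow> d \<in> S \<Longrightarrow> 0 < r c d"
  obtains p where "p \<in> distributions_on S" "stationary S r (pmf p)" "\<And>c. c \<in> S \<Longrightarrow> 0 < pmf p c"
proof -
  \<comment> \<open>\<open>Q d c\<close> is the generator entry from \<open>c\<close> to \<open>d\<close>: it acts on functions by drift and on
    distributions by net inflow.\<close>
  define Q where "Q d c = r c d - (if c = d then \<Sum>e\<in>S. r c e else 0)" for d c
  have Q_drift: "(\<Sum>d\<in>S. f d * Q d c) = (\<Sum>d\<in>S. r c d * (f d - f c))" if "c \<in> S" for f c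
  proof -
    have "(\<Sum>d\<in>S. f d * Q d c) = (\<Sum>d\<in>S. f d * r c d)
        - (\<Sum>d\<in>S. if c = d then f d * (\<Sum>e\<in>S. r c e) else 0)"
      unfolding Q_def sum_subtractf[symmetric] by (intro sum.cong) (auto simp: algebra_simps)
    also have "(\<Sum>d\<in>S. if c = d then f d * (\<Sum>e\<in>S. r c e) else 0) = f c * (\<Sum>e\<in>S. r c e)"
      using assms(1) that by (subst sum.delta') auto
    finally show ?thesis
      by (simp add: algebra_simps sum_subtractf sum_distrib_left)
  qed
  have Q_flow: "(\<Sum>c\<in>S. Q d c * x c) = (\<Sum>c\<in>S. x c * r c d) - x d * (\<Sum>e\<in>S. r d e)"
    if "d \<in> S" for x d
  proof -
    have "(\<Sum>c\<in>S. Q d c * x c) = (\<Sum>c\<in>S. x c * r c d)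
        - (\<Sum>c\<in>S. if c = d then x c * (\<Sum>e\<in>S. r c e) else 0)"
      unfolding Q_def sum_subtractf[symmetric] by (intro sum.cong) (auto simp: algebra_simps)
    also have "(\<Sum>c\<in>S. if c = d then x c * (\<Sum>e\<in>S. r c e) else 0) = x d * (\<Sum>e\<in>S. r d e)"
      using assms(1) that by (subst sum.delta) auto
    finally show ?thesis .
  qed
  have "\<exists>x. (\<forall>c\<in>S. 0 \<le> x c) \<and> (\<forall>d\<in>S. (\<Sum>c\<in>S. Q d c * x c) \<le> 0) \<and> 0 < sum x S"
  proof (rule ccontr)
    assume no: "\<not> ?thesis"
    have "(\<Sum>c\<in>S. 1 * x c) \<le> 0"
      if "\<And>c. c \<in> S \<Longrightarrow> 0 \<le> x c" "\<And>d. d \<in> S \<Longrightarrow> (\<Sum>c\<in>S. Q d c * x c) \<le> 0" for x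
      using no that by (auto simp: not_less)
    then obtain l where l: "\<And>c. c \<in> S \<Longrightarrow> 1 \<le> (\<Sum>d\<in>S. l d * Q d c)"
      using farkas_nonneg[of S S Q "\<lambda>_. 1"] assms(1) by blast
    then have drift: "1 \<le> (\<Sum>d\<in>S. r c d * (l d - l c))" if "c \<in> S" for c
      using that by (simp add: Q_drift)
    have nonneg: "0 \<le> (\<Sum>d\<in>S. r c d * (l d - l c))" if "c \<in> S" for c
      using drift[OF that] by linarith
    have const: "l c = l d" if "c \<in> S" "d \<in> S" for c d
      using nonneg_drift_imp_constant[where f = l, OF assms(1) r nonneg, of c d] that by simp
    obtain c where c: "c \<in> S"
      using assms(2) by blast
    then have "(\<Sum>d\<in>S. r c d * (l d - l c)) = 0"
      using const[OF _ c] by (intro sum.neutral ballI) (metis diff_self mult_zero_right)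
    with drift[OF c] show False
      by simp
  qed
  then obtain x where x: "\<And>c. c \<in> S \<Longrightarrow> 0 \<le> x c"
      "\<And>d. d \<in> S \<Longrightarrow> (\<Sum>c\<in>S. Q d c * x c) \<le> 0" "0 < sum x S"
    by blast
  obtain p where p: "p \<in> distributions_on S" "\<And>c. c \<in> S \<Longrightarrow> pmf p c = x c / sum x S"
    using pmf_of_weights[of S x] assms(1) x by blast
  have flow0: "(\<Sum>c\<in>S. Q d c * x c) = 0" if "d \<in> S" for d
  proof -
    have "(\<Sum>d\<in>S. \<Sum>c\<in>S. Q d c * x c) = (\<Sum>c\<in>S. x c * (\<Sum>d\<in>S. 1 * Q d c))"
      by (subst sum.swap) (simp add: sum_distrib_left mult_ac)
    also have "\<dots> = 0"
      using Q_drift[where f = "\<lambda>_. 1"] by (intro sum.neutral) simp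
    finally have "(\<Sum>d\<in>S. - (\<Sum>c\<in>S. Q d c * x c)) = 0"
      by (simp add: sum_negf)
    then show ?thesis
      using that x(2) assms(1) by (subst (asm) sum_nonneg_eq_0_iff) auto
  qed
  have stat: "stationary S r (pmf p)"
    unfolding stationary_def
  proof
    fix d assume d: "d \<in> S"
    have "(\<Sum>c\<in>S. pmf p c * r c d) = (\<Sum>c\<in>S. x c * r c d) / sum x S"
      by (simp add: p(2) sum_divide_distrib)
    also have "\<dots> = pmf p d * (\<Sum>e\<in>S. r d e)"
      using flow0[OF d] d by (simp add: Q_flow p(2))
    finally show "(\<Sum>c\<in>S. pmf p c * r c d) = pmf p d * (\<Sum>e\<in>S. r d e)" .
  qed
  have pos: "0 < pmf p d" if d: "d \<in> S" for d
  proof (rule ccontr)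
    assume "\<not> 0 < pmf p d"
    then have "(\<Sum>c\<in>S. pmf p c * r c d) = 0"
      using stat d by (simp add: stationary_def not_less)
    then have "\<forall>c\<in>S. pmf p c * r c d = 0"
      using assms(1) r d by (subst (asm) sum_nonneg_eq_0_iff) (auto simp: less_imp_le)
    then have "\<forall>c\<in>S. x c = 0"
      using p(2) x(3) r d by (metis divide_eq_0_iff less_irrefl mult_eq_0_iff)
    then show False
      using x(3) by simp
  qed
  show thesis
    by (rule that[OF p(1) stat pos])
qed

section \<open>Deviations in a finite game\<close>

lemma sum_profiles_split:
  assumes "i \<in> N"
  shows "(\<Sum>c\<in>profiles N C. F c) = (\<Sum>e\<in>C i. \<Sum>c\<in>profiles_without N C i. F (c(i := e)))"
proof -
  have "N = insert i (N - {i})"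
    using assms by auto
  then have "profiles N C = (\<lambda>(e, c). c(i := e)) ` (C i \<times> profiles_without N C i)"
    using PiE_insert_eq[of i "N - {i}" C] by simp
  moreover have "inj_on (\<lambda>(e, c). c(i := e)) (C i \<times> profiles_without N C i)"
    using inj_combinator[of i "N - {i}" C] by simp
  ultimately have "(\<Sum>c\<in>profiles N C. F c)
      = (\<Sum>x\<in>C i \<times> profiles_without N C i. F (case x of (e, c) \<Rightarrow> c(i := e)))"
    by (simp only: sum.reindex o_def)
  then show ?thesis
    by (simp add: sum.cartesian_product case_prod_beta)
qed

lemma finite_profiles: "finite_game N C \<Longrightarrow> finite (profiles N C)"
  unfolding finite_game_def by (auto intro: finite_PiE)

text \<open>
  The coefficient vectors of the incentive constraints, each indexed by a player, the recommended
  strategy, and the deviation.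
\<close>

definition deviation_gain ::
  "('i \<Rightarrow> ('i \<Rightarrow> 's) \<Rightarrow> real) \<Rightarrow> 'i \<times> 's \<times> 's \<Rightarrow> ('i \<Rightarrow> 's) \<Rightarrow> real" where
  "deviation_gain U = (\<lambda>(i, e, d) c. if c i = e then U i (c(i := d)) - U i c else 0)"

lemma incentive_eq_sum_profiles:
  assumes "finite_game N C" "i \<in> N" "e \<in> C i"
  shows "incentive N C U \<mu> i e d = (\<Sum>c\<in>profiles N C. deviation_gain U (i, e, d) c * pmf \<mu> c)"
proof -
  have "finite (C i)"
    using assms by (auto simp: finite_game_def)
  have "(\<Sum>c\<in>profiles N C. deviation_gain U (i, e, d) c * pmf \<mu> c)
      = (\<Sum>e'\<in>C i. if e' = e then incentive N C U \<mu> i e d else 0)"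
    unfolding sum_profiles_split[OF assms(2)] incentive_def
    by (intro sum.cong) (auto simp: deviation_gain_def mult_ac)
  also have "\<dots> = incentive N C U \<mu> i e d"
    using \<open>finite (C i)\<close> assms(3) by (subst sum.delta) auto
  finally show ?thesis ..
qed

text \<open>
  Any nonnegative solution of the incentive inequalities is zero or a multiple of a correlated
  equilibrium, so tightness turns each of its inequalities into an equation. Hence the system implies
  the reverse of each constraint \<open>k\<close>, and Farkas' lemma gives \<open>l k \<ge> 0\<close> such that constraint \<open>k\<close>
  plus the combination with weights \<open>l k\<close> is nonnegative at every profile. In the sum over
  all \<open>k\<close> every constraint has weight at least \<open>1\<close>.
\<close>

lemma tight_game_dual:
  assumes game: "finite_game N C" and tight: "tight_game N C U"
  obtains \<alpha> :: "'i \<Rightarrow> 's \<Rightarrow> 's \<Rightarrow> real"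
    where "\<And>i e d. i \<in> N \<Longrightarrow> e \<in> C i \<Longrightarrow> d \<in> C i \<Longrightarrow> 0 < \<alpha> i e d"
      and "\<And>c. c \<in> profiles N C \<Longrightarrow>
        0 \<le> (\<Sum>i\<in>N. \<Sum>d\<in>C i. \<alpha> i (c i) d * (U i (c(i := d)) - U i c))"
proof -
  define J where "J = (SIGMA i:N. C i \<times> C i)"
  have finC: "finite (C i)" if "i \<in> N" for i
    using game that by (auto simp: finite_game_def)
  have finN: "finite N"
    using game by (auto simp: finite_game_def)
  have finJ: "finite J"
    unfolding J_def using finN finC by auto
  have "\<exists>l. (\<forall>j\<in>J. 0 \<le> l j) \<and>
      (\<forall>c\<in>profiles N C. - deviation_gain U k c \<le> (\<Sum>j\<in>J. l j * deviation_gain U j c))"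
    if k: "k \<in> J" for k
  proof (rule farkas_nonneg[OF finJ finite_profiles[OF game]])
    fix x :: "('i \<Rightarrow> 's) \<Rightarrow> real"
    assume nonneg: "\<And>c. c \<in> profiles N C \<Longrightarrow> 0 \<le> x c"
      and x: "\<And>j. j \<in> J \<Longrightarrow> (\<Sum>c\<in>profiles N C. deviation_gain U j c * x c) \<le> 0"
    show "(\<Sum>c\<in>profiles N C. - deviation_gain U k c * x c) \<le> 0"
    proof (cases "sum x (profiles N C) = 0")
      case True
      then have "\<forall>c\<in>profiles N C. x c = 0"
        using nonneg finite_profiles[OF game] by (subst (asm) sum_nonneg_eq_0_iff) auto
      then show ?thesis by simp
    next
      case False
      define s where "s = sum x (profiles N C)"
      have s: "0 < s"
        using False sum_nonneg[OF nonneg] unfolding s_def by (simp add: order_less_le)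
      obtain \<mu> where \<mu>: "\<mu> \<in> distributions_on (profiles N C)"
          "\<And>c. c \<in> profiles N C \<Longrightarrow> pmf \<mu> c = x c / s"
        using pmf_of_weights[of "profiles N C" x] finite_profiles[OF game] nonneg s
        unfolding s_def by blast
      have inc: "incentive N C U \<mu> i e d = (\<Sum>c\<in>profiles N C. deviation_gain U (i, e, d) c * x c) / s"
        if "(i, e, d) \<in> J" for i e d
        using that
        by (simp add: J_def incentive_eq_sum_profiles[OF game] \<mu>(2) sum_divide_distrib)
      have "correlated_equilibrium N C U \<mu>"
        unfolding correlated_equilibrium_def using \<mu>(1) s inc x
        by (auto simp: J_def divide_nonpos_pos)
      moreover obtain i e d where ied: "k = (i, e, d)"
        by (cases k)
      ultimately have "incentive N C U \<mu> i e d = 0"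
        using tight k unfolding tight_game_def J_def by blast
      then show ?thesis
        using inc k s by (simp add: ied sum_negf)
    qed
  qed
  then obtain l where l: "\<And>k j. k \<in> J \<Longrightarrow> j \<in> J \<Longrightarrow> 0 \<le> l k j"
      "\<And>k c. k \<in> J \<Longrightarrow> c \<in> profiles N C \<Longrightarrow>
        - deviation_gain U k c \<le> (\<Sum>j\<in>J. l k j * deviation_gain U j c)"
    by metis
  define \<alpha> where "\<alpha> i e d = 1 + (\<Sum>k\<in>J. l k (i, e, d))" for i e d
  show thesis
  proof (rule that[of \<alpha>])
    fix i e d assume "i \<in> N" "e \<in> C i" "d \<in> C i"
    then have "0 \<le> (\<Sum>k\<in>J. l k (i, e, d))"
      using l(1) by (intro sum_nonneg) (auto simp: J_def)
    then show "0 < \<alpha> i e d"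
      unfolding \<alpha>_def by simp
  next
    fix c assume c: "c \<in> profiles N C"
    have "0 \<le> (\<Sum>k\<in>J. deviation_gain U k c + (\<Sum>j\<in>J. l k j * deviation_gain U j c))"
      using l(2) c by (intro sum_nonneg) force
    also have "\<dots> = (\<Sum>j\<in>J. deviation_gain U j c) + (\<Sum>j\<in>J. \<Sum>k\<in>J. l k j * deviation_gain U j c)"
      unfolding sum.distrib by (subst (2) sum.swap) simp
    also have "\<dots> = (\<Sum>(i, e, d)\<in>J. \<alpha> i e d * deviation_gain U (i, e, d) c)"
      unfolding \<alpha>_def by (simp add: case_prod_beta algebra_simps sum.distrib sum_distrib_left)
    also have "\<dots> = (\<Sum>i\<in>N. \<Sum>e\<in>C i. \<Sum>d\<in>C i. \<alpha> i e d * deviation_gain U (i, e, d) c)"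
      unfolding J_def using finN finC
      by (subst sum.Sigma[symmetric]) (auto simp: sum.cartesian_product case_prod_beta)
    also have "\<dots> = (\<Sum>i\<in>N. \<Sum>d\<in>C i. \<alpha> i (c i) d * (U i (c(i := d)) - U i c))"
    proof (rule sum.cong[OF refl])
      fix i assume i: "i \<in> N"
      then have "c i \<in> C i"
        using c by auto
      have "(\<Sum>e\<in>C i. \<Sum>d\<in>C i. \<alpha> i e d * deviation_gain U (i, e, d) c)
          = (\<Sum>e\<in>C i. if c i = e then \<Sum>d\<in>C i. \<alpha> i e d * (U i (c(i := d)) - U i c) else 0)"
        by (intro sum.cong) (auto simp: deviation_gain_def)
      also have "\<dots> = (\<Sum>d\<in>C i. \<alpha> i (c i) d * (U i (c(i := d)) - U i c))"
        using finC[OF i] \<open>c i \<in> C i\<close> by (subst sum.delta') auto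
      finally show "(\<Sum>e\<in>C i. \<Sum>d\<in>C i. \<alpha> i e d * deviation_gain U (i, e, d) c)
          = (\<Sum>d\<in>C i. \<alpha> i (c i) d * (U i (c(i := d)) - U i c))" .
    qed
    finally show "0 \<le> (\<Sum>i\<in>N. \<Sum>d\<in>C i. \<alpha> i (c i) d * (U i (c(i := d)) - U i c))" .
  qed
qed

section \<open>Payoffs against independent opponents\<close>

text \<open>
  The opponents' strategies enter as real weights, so that point masses and
  distributions are treated alike.
\<close>

definition payoff_against ::
  "'i set \<Rightarrow> ('i \<Rightarrow> 's set) \<Rightarrow> ('i \<Rightarrow> 's \<Rightarrow> real) \<Rightarrow> 'i \<Rightarrow> (('i \<Rightarrow> 's) \<Rightarrow> real) \<Rightarrow> 's \<Rightarrow> real" where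
  "payoff_against N C w i u d =
     (\<Sum>c\<in>profiles_without N C i. (\<Prod>j\<in>N - {i}. w j (c j)) * u (c(i := d)))"

lemma payoff_against_cong:
  assumes "\<And>j. j \<in> N \<Longrightarrow> j \<noteq> i \<Longrightarrow> w j = w' j"
  shows "payoff_against N C w i u = payoff_against N C w' i u"
  unfolding payoff_against_def using assms
  by (intro ext sum.cong arg_cong2[where f = "(*)"] prod.cong) auto

lemma sum_profiles_product:
  fixes w :: "'i \<Rightarrow> 's \<Rightarrow> real"
  assumes "finite N" "i \<in> N"
  shows "(\<Sum>c\<in>profiles N C. (\<Prod>j\<in>N. w j (c j)) * F c)
    = (\<Sum>e\<in>C i. w i e * (\<Sum>c\<in>profiles_without N C i. (\<Prod>j\<in>N - {i}. w j (c j)) * F (c(i := e))))"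
proof -
  have "(\<Prod>j\<in>N. w j ((c(i := e)) j)) = w i e * (\<Prod>j\<in>N - {i}. w j (c j))" for c e
    using assms by (subst prod.remove[of _ i]) auto
  then show ?thesis
    unfolding sum_profiles_split[OF assms(2)] by (simp add: sum_distrib_left mult_ac)
qed

lemma mixed_utility_eq_payoff_against:
  assumes "finite N" "i \<in> N"
  shows "mixed_utility N C U i \<sigma>
    = (\<Sum>e\<in>C i. pmf (\<sigma> i) e * payoff_against N C (\<lambda>j. pmf (\<sigma> j)) i (U i) e)"
  unfolding mixed_utility_def payoff_against_def by (rule sum_profiles_product[OF assms])

text \<open>
  Under independent play, averaging the effect of one player's jumps first over the opponents
  reduces it to the drift of that player's expected payoff. By \<open>stationary_mean_drift\<close> it therefore
  vanishes whenever \<open>w i\<close> is stationary.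
\<close>

lemma expected_drift:
  assumes "finite N" "i \<in> N"
  shows "(\<Sum>c\<in>profiles N C. (\<Prod>j\<in>N. w j (c j)) * (\<Sum>d\<in>C i. r (c i) d * (u (c(i := d)) - u c)))
    = (\<Sum>e\<in>C i. w i e * (\<Sum>d\<in>C i. r e d *
        (payoff_against N C w i u d - payoff_against N C w i u e)))"
proof -
  have "(\<Sum>c\<in>profiles_without N C i. (\<Prod>j\<in>N - {i}. w j (c j)) *
        (\<Sum>d\<in>C i. r e d * (u (c(i := d)) - u (c(i := e)))))
      = (\<Sum>d\<in>C i. r e d * (payoff_against N C w i u d - payoff_against N C w i u e))" for e
    unfolding payoff_against_def sum_subtractf[symmetric] sum_distrib_left
    by (subst sum.swap) (simp add: algebra_simps)
  then show ?thesis
    by (simp add: sum_profiles_product[OF assms, where C = C and w = w and F =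
          "\<lambda>c. \<Sum>d\<in>C i. r (c i) d * (u (c(i := d)) - u c)"])
qed

section \<open>The equilibrium\<close>

theorem proposition5:
  fixes N :: "'i set"
    and C :: "'i \<Rightarrow> 's set"
    and U :: "'i \<Rightarrow> ('i \<Rightarrow> 's) \<Rightarrow> real"
  assumes "finite_game N C"
    and "tight_game N C U"
  shows "\<exists>\<sigma>. nash_equilibrium N C U \<sigma> \<and> completely_mixed N C \<sigma>"
proof -
  have finN: "finite N" and C: "\<And>i. i \<in> N \<Longrightarrow> finite (C i)" "\<And>i. i \<in> N \<Longrightarrow> C i \<noteq> {}"
    using assms(1) by (auto simp: finite_game_def)
  obtain \<alpha> :: "'i \<Rightarrow> 's \<Rightarrow> 's \<Rightarrow> real" where
    \<alpha>_pos: "\<And>i e d. i \<in> N \<Longrightarrow> e \<in> C i \<Longrightarrow> d \<in> C i \<Longrightarrow> 0 < \<alpha> i e d" and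
    \<alpha>_dual: "\<And>c. c \<in> profiles N C \<Longrightarrow>
        0 \<le> (\<Sum>i\<in>N. \<Sum>d\<in>C i. \<alpha> i (c i) d * (U i (c(i := d)) - U i c))"
    using tight_game_dual[OF assms] by blast
  have "\<exists>p. p \<in> distributions_on (C i) \<and> stationary (C i) (\<alpha> i) (pmf p) \<and> (\<forall>c\<in>C i. 0 < pmf p c)"
    if "i \<in> N" for i
    using stationary_pmf_exists[of "C i" "\<alpha> i"] C \<alpha>_pos that by metis
  then obtain \<sigma> where \<sigma>: "\<And>i. i \<in> N \<Longrightarrow> \<sigma> i \<in> distributions_on (C i)"
      "\<And>i. i \<in> N \<Longrightarrow> stationary (C i) (\<alpha> i) (pmf (\<sigma> i))"
      "\<And>i c. i \<in> N \<Longrightarrow> c \<in> C i \<Longrightarrow> 0 < pmf (\<sigma> i) c"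
    by metis
  define V where "V k = payoff_against N C (\<lambda>j. pmf (\<sigma> j)) k (U k)" for k
  have V_drift: "0 \<le> (\<Sum>d\<in>C k. \<alpha> k e d * (V k d - V k e))" if k: "k \<in> N" and e: "e \<in> C k" for k e
  proof -
    \<comment> \<open>Player \<open>k\<close> is fixed at \<open>e\<close>, and the others play their stationary distributions.\<close>
    define w where "w = (\<lambda>j. pmf (\<sigma> j))(k := \<lambda>x. if x = e then 1 else 0)"
    define D where "D i = (\<Sum>c\<in>profiles N C. (\<Prod>j\<in>N. w j (c j)) *
        (\<Sum>d\<in>C i. \<alpha> i (c i) d * (U i (c(i := d)) - U i c)))" for i
    have w_nonneg: "0 \<le> w j x" for j x
      by (simp add: w_def)
    have "0 \<le> (\<Sum>c\<in>profiles N C. (\<Prod>j\<in>N. w j (c j)) *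
        (\<Sum>i\<in>N. \<Sum>d\<in>C i. \<alpha> i (c i) d * (U i (c(i := d)) - U i c)))"
      by (intro sum_nonneg mult_nonneg_nonneg prod_nonneg w_nonneg \<alpha>_dual)
    also have "\<dots> = (\<Sum>i\<in>N. D i)"
      unfolding D_def sum_distrib_left[where A = N] by (rule sum.swap)
    also have "\<dots> = D k + (\<Sum>i\<in>N - {k}. D i)"
      using finN k by (rule sum.remove)
    also have "(\<Sum>i\<in>N - {k}. D i) = 0"
    proof (rule sum.neutral, rule ballI)
      fix i assume i: "i \<in> N - {k}"
      then have "stationary (C i) (\<alpha> i) (w i)"
        using \<sigma>(2) by (simp add: w_def)
      then show "D i = 0"
        using i finN unfolding D_def by (simp add: expected_drift stationary_mean_drift)
    qed
    also have "D k + 0 = (\<Sum>x\<in>C k. if x = e then \<Sum>d\<in>C k. \<alpha> k x d * (V k d - V k x) else 0)"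
    proof -
      have "payoff_against N C w k (U k) = V k"
        unfolding V_def w_def by (rule payoff_against_cong) simp
      then show ?thesis
        unfolding D_def expected_drift[OF finN k] by (auto simp: w_def intro!: sum.cong)
    qed
    also have "\<dots> = (\<Sum>d\<in>C k. \<alpha> k e d * (V k d - V k e))"
      using C(1)[OF k] e by (subst sum.delta) auto
    finally show ?thesis .
  qed
  have indifferent: "mixed_utility N C U k (\<sigma>(k := \<tau>)) = V k d"
    if k: "k \<in> N" and \<tau>: "\<tau> \<in> distributions_on (C k)" and d: "d \<in> C k" for k \<tau> d
  proof -
    have "payoff_against N C (\<lambda>j. pmf ((\<sigma>(k := \<tau>)) j)) k (U k) = V k"
      unfolding V_def by (rule payoff_against_cong) simp
    then have "mixed_utility N C U k (\<sigma>(k := \<tau>)) = (\<Sum>e\<in>C k. pmf \<tau> e * V k e)"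
      by (simp only: mixed_utility_eq_payoff_against[OF finN k] fun_upd_same)
    also have "\<dots> = (\<Sum>e\<in>C k. pmf \<tau> e) * V k d"
      unfolding sum_distrib_right
      using nonneg_drift_imp_constant[where f = "V k", OF C(1)[OF k] \<alpha>_pos V_drift] k d
      by (intro sum.cong) (metis (no_types, lifting))+
    also have "(\<Sum>e\<in>C k. pmf \<tau> e) = 1"
      using \<tau> C(1)[OF k] by (intro sum_pmf_eq_1) (auto simp: distributions_on_def)
    finally show ?thesis by (simp only: mult_1_left)
  qed
  have "mixed_utility N C U k (\<sigma>(k := \<tau>)) \<le> mixed_utility N C U k \<sigma>"
    if k: "k \<in> N" and \<tau>: "\<tau> \<in> distributions_on (C k)" for k \<tau>
  proof -
    obtain d where "d \<in> C k"
      using C(2)[OF k] by blast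
    then show ?thesis
      using indifferent[OF k \<tau>] indifferent[OF k \<sigma>(1)[OF k]] by simp
  qed
  then have "nash_equilibrium N C U \<sigma>"
    using \<sigma>(1) unfolding nash_equilibrium_def mixed_profile_def by blast
  moreover have "completely_mixed N C \<sigma>"
    using \<sigma>(3) unfolding completely_mixed_def by blast
  ultimately show ?thesis by blast
qed

end
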